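(* Let $G=(N,\{\Sigma_i\}_{i\in N},\{C_i\}_{i\in N})$ be a (cost-minimization) social contribution game with sum-bounded social cost $C$. Then $G$ is altruism-independently smooth, i.e., for every $\alpha=(\alpha_i)_{i\in N}\in[0,1]^N$, the robust price of anarchy of the $\alpha$-altruistic extension $G^\alpha$ of $G$ equals the robust price of anarchy of $G$.
   Context: A cost-minimization game $G=(N,\{\Sigma_i\}_{i\in N},\{C_i\}_{i\in N})$ has a finite player set $N$, strategy sets $\Sigma_i$, profiles $\Sigma=\prod_{i\in N}\Sigma_i$, and cost functions $C_i:\Sigma\to\mathbb R$; it comes with a social cost function $C:\Sigma\to\mathbb R$. $C$ is sum-bounded if $C(s)\le\sum_{i\in N}C_i(s)$ for all $s\in\Sigma$. $(t_i,s_{-i})$ denotes the profile $s$ with player $i$'s strategy replaced by $t_i$. Social contribution game (SCG): for every player $i$ there is a default strategy $\emptyset_i$ such that $C_i(s)=C(s)-C(\emptyset_i,s_{-i})$ for all $s\in\Sigma$. (The strategy $\emptyset_i$, "not participating", need not belong to $\Sigma_i$; in that case $C$ is understood to be extended to a real-valued function on $\prod_{i\in N}(\Sigma_i\cup\{\emptyset_i\})$.) Altruistic extension: for $\alpha\in[0,1]^N$, $G^\alpha=(N,\{\Sigma_i\},\{C_i^\alpha\})$ with $C_i^\alpha=(1-\alpha_i)C_i+\alpha_iC$; its social cost is again $C$. In particular $G^{\mathbf 0}=G$. Smoothness (for $G$ with sum-bounded social cost): write $C_{-i}:=C-C_i$. $G^\alpha$ is $(\lambda,\mu)$-smooth if there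 is an optimal profile $s^*$ (a minimizer of $C$ over $\Sigma$) such that for all $s\in\Sigma$, $$\sum_{i\in N}\big(C_i(s_i^*,s_{-i})+\alpha_i(C_{-i}(s_i^*,s_{-i})-C_{-i}(s))\big)\le\lambda C(s^* )+\mu C(s).$$ The robust price of anarchy of $G^\alpha$ is $\inf\{\frac{\lambda}{1-\mu} : G^\alpha\text{ is }(\lambda,\mu)\text{-smooth},\ \mu<1\}$; the robust price of anarchy of $G$ is that of $G^{\mathbf 0}$. *)

theory Defs
  imports "HOL-Library.FuncSet" "HOL-Library.Extended_Real"
begin

text \<open>
  All strategies live in one ambient type. Only the values of \<open>cost\<close> on \<open>profiles G\<close> matter.
  The values of \<open>social_cost\<close> outside \<open>profiles G\<close> matter only in
  \<open>social_contribution_game\<close>, where a default strategy may lie outside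
  the strategy set of its player; there they give the extension of the social cost to profiles
  with non-participating players.
\<close>

record ('i, 's) cost_game =
  players :: "'i set"
  strategies :: "'i \<Rightarrow> 's set"
  cost :: "'i \<Rightarrow> ('i \<Rightarrow> 's) \<Rightarrow> real"
  social_cost :: "('i \<Rightarrow> 's) \<Rightarrow> real"

definition profiles :: "('i, 's) cost_game \<Rightarrow> ('i \<Rightarrow> 's) set" where
  "profiles G = (\<Pi>\<^sub>E i\<in>players G. strategies G i)"

definition sum_bounded :: "('i, 's) cost_game \<Rightarrow> bool" where
  "sum_bounded G \<longleftrightarrow>
     (\<forall>s\<in>profiles G. social_cost G s \<le> (\<Sum>i\<in>players G. cost G i s))"

text \<open>The default strategy \<open>d i\<close> is deliberately not required to be in \<open>strategies G i\<close>.\<close>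

definition social_contribution_game :: "('i, 's) cost_game \<Rightarrow> bool" where
  "social_contribution_game G \<longleftrightarrow>
     (\<exists>d. \<forall>i\<in>players G. \<forall>s\<in>profiles G.
        cost G i s = social_cost G s - social_cost G (s(i := d i)))"

definition altruistic_extension ::
  "('i, 's) cost_game \<Rightarrow> ('i \<Rightarrow> real) \<Rightarrow> ('i, 's) cost_game" where
  "altruistic_extension G \<alpha> =
     G\<lparr>cost := \<lambda>i s. (1 - \<alpha> i) * cost G i s + \<alpha> i * social_cost G s\<rparr>"

definition others_cost :: "('i, 's) cost_game \<Rightarrow> 'i \<Rightarrow> ('i \<Rightarrow> 's) \<Rightarrow> real" where
  "others_cost G i s = social_cost G s - cost G i s"

definition optimal_profile :: "('i, 's) cost_game \<Rightarrow> ('i \<Rightarrow> 's) \<Rightarrow> bool" where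
  "optimal_profile G s \<longleftrightarrow>
     s \<in> profiles G \<and> (\<forall>t\<in>profiles G. social_cost G s \<le> social_cost G t)"

text \<open>
  Smoothness of the \<open>\<alpha>\<close>-altruistic extension of \<open>G\<close>. It is a property of the pair
  \<open>(G, \<alpha>)\<close>, since the inequality refers to the costs of the underlying game, which the
  extension does not determine (if \<open>\<alpha> = 1\<close>, every player's cost in the extension is the
  social cost). Lemma \<open>altruistic_smooth_iff\<close> expresses it through the costs of the extension.
\<close>

definition altruistic_smooth ::
  "('i, 's) cost_game \<Rightarrow> ('i \<Rightarrow> real) \<Rightarrow> real \<Rightarrow> real \<Rightarrow> bool" where
  "altruistic_smooth G \<alpha> l m \<longleftrightarrow>
     (\<exists>opt. optimal_profile G opt \<and>
        (\<forall>s\<in>profiles G.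
           (\<Sum>i\<in>players G. cost G i (s(i := opt i)) +
              \<alpha> i * (others_cost G i (s(i := opt i)) - others_cost G i s))
           \<le> l * social_cost G opt + m * social_cost G s))"

text \<open>
  The infimum is taken in the extended reals: it is \<open>\<infinity>\<close> if no admissible pair exists, and the
  set need not be bounded below.
\<close>

definition altruistic_robust_poa :: "('i, 's) cost_game \<Rightarrow> ('i \<Rightarrow> real) \<Rightarrow> ereal" where
  "altruistic_robust_poa G \<alpha> =
     Inf {ereal (l / (1 - m)) | l m. altruistic_smooth G \<alpha> l m \<and> m < 1}"

definition robust_poa :: "('i, 's) cost_game \<Rightarrow> ereal" where
  "robust_poa G = altruistic_robust_poa G (\<lambda>_. 0)"

definition altruism_independently_smooth :: "('i, 's) cost_game \<Rightarrow> bool" where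
  "altruism_independently_smooth G \<longleftrightarrow>
     (\<forall>\<alpha> \<in> players G \<rightarrow> {0..1}. altruistic_robust_poa G \<alpha> = robust_poa G)"

lemma altruistic_extension_zero: "altruistic_extension G (\<lambda>_. 0) = G"
  by (simp add: altruistic_extension_def)

lemma altruistic_smooth_iff:
  "altruistic_smooth G \<alpha> l m \<longleftrightarrow>
     (\<exists>opt. optimal_profile (altruistic_extension G \<alpha>) opt \<and>
        (\<forall>s\<in>profiles (altruistic_extension G \<alpha>).
           (\<Sum>i\<in>players G. cost (altruistic_extension G \<alpha>) i (s(i := opt i))
              - \<alpha> i * others_cost G i s)
           \<le> l * social_cost G opt + m * social_cost G s))"
  by (simp add: altruistic_smooth_def altruistic_extension_def others_cost_def
      optimal_profile_def profiles_def algebra_simps)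

end

theory Submission
  imports Defs
begin

text \<open>
  In a social contribution game \<open>others_cost G i s\<close> is the social cost without player \<open>i\<close>, which
  does not depend on the strategy of \<open>i\<close>. The altruistic terms of the smoothness inequality
  therefore vanish, so the same pairs are admissible for every \<open>\<alpha>\<close>.
\<close>

lemma profiles_update:
  assumes "s \<in> profiles G" "t \<in> profiles G" "i \<in> players G"
  shows "s(i := t i) \<in> profiles G"
  using assms by (auto simp: profiles_def PiE_iff extensional_def)

text \<open>With a default strategy \<open>d\<close>, both sides equal
  \<open>social_cost G (s(i := d i))\<close>: the update by \<open>d i\<close> overwrites the one by
  \<open>x\<close>.\<close>

lemma others_cost_update:
  assumes "social_contribution_game G" "i \<in> players G" "s \<in> profiles G" "s(i := x) \<in> profiles G"
  shows "others_cost G i (s(i := x)) = others_cost G i s"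
  using assms by (auto simp: social_contribution_game_def others_cost_def)

lemma altruistic_smooth_independent:
  assumes "social_contribution_game G"
  shows "altruistic_smooth G \<alpha> l m \<longleftrightarrow> altruistic_smooth G \<beta> l m"
proof -
  have "(\<Sum>i\<in>players G. cost G i (s(i := opt i)) +
            \<gamma> i * (others_cost G i (s(i := opt i)) - others_cost G i s)) =
        (\<Sum>i\<in>players G. cost G i (s(i := opt i)))"
    if "optimal_profile G opt" "s \<in> profiles G" for opt s \<gamma>
    \<comment> \<open>Optimality puts \<open>opt\<close> in \<open>profiles G\<close>, so each
      deviation \<open>s(i := opt i)\<close> is a profile and its altruistic term is zero.\<close>
    using that assms
    by (intro sum.cong refl) (simp add: optimal_profile_def profiles_update others_cost_update)
  then have "altruistic_smooth G \<gamma> l m \<longleftrightarrow> (\<exists>opt. optimal_profile G opt \<and> (\<forall>s\<in>profiles G.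
      (\<Sum>i\<in>players G. cost G i (s(i := opt i))) \<le> l * social_cost G opt + m * social_cost G s))"
    for \<gamma>
    unfolding altruistic_smooth_def by (intro ex_cong1 conj_cong ball_cong refl) simp
  then show ?thesis
    by simp
qed

theorem lemma1:
  fixes G :: "('i, 's) cost_game"
  assumes "finite (players G)"
    and "social_contribution_game G"
    and "sum_bounded G"
  shows "altruism_independently_smooth G"
proof -
  \<comment> \<open>Stated as an equality of predicates in \<open>l\<close> and \<open>m\<close>,
    because the infimum depends on \<alpha> only through this predicate.\<close>
  have "altruistic_smooth G \<alpha> = altruistic_smooth G (\<lambda>_. 0)" for \<alpha>
    by (intro ext altruistic_smooth_independent assms(2))
  then have "altruistic_robust_poa G \<alpha> = altruistic_robust_poa G (\<lambda>_. 0)" for \<alpha>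
    unfolding altruistic_robust_poa_def by (rule arg_cong)
  then show ?thesis
    unfolding altruism_independently_smooth_def robust_poa_def by (intro ballI)
qed

end
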